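(* For all $\lambda,\mu,\nu,\rho\in\mathcal P$ satisfying $\lambda\subseteq\mu$ and $\nu\subseteq\rho$, $$g_{\lambda,\mu}\cdot g_{\nu,\rho}\ \le\ g_{\lambda\vee\nu,\ \mu\vee\rho}\cdot g_{\lambda\wedge\nu,\ \mu\wedge\rho}.$$
   Context: $\mathcal P$ is the set of all integer partitions, viewed as infinite nonincreasing sequences of nonnegative integers with finitely many nonzero entries; $\vee,\wedge$ are the componentwise maximum and minimum; $\lambda\subseteq\mu$ means $\lambda_i\le\mu_i$ for all $i$. For $\lambda\subseteq\mu$, $g_{\lambda,\mu}$ is the number of increasing tableaux of skew shape $\mu/\lambda$: fillings of the boxes of $\mu/\lambda$ by positive integers that are strictly increasing along rows and strictly increasing down columns, and such that every entry in row $i$ lies in $\{1,2,\ldots,i-1\}$ (so $g_{\lambda,\lambda}=1$). *)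

theory Defs
  imports "HOL-Library.FuncSet"
begin

text \<open>
  Rows and columns are indexed from 0, so \<open>lam i\<close> is the part usually written
  \<open>\<lambda>\<^bsub>i+1\<^esub>\<close>. Since partitions are functions of type \<open>nat \<Rightarrow> nat\<close>, containment and the
  componentwise maximum and minimum are the pointwise \<open>\<le>\<close>, \<open>sup\<close> and \<open>inf\<close>.
\<close>

definition partitions :: "(nat \<Rightarrow> nat) set" where
  "partitions = {lam. antimono lam \<and> finite {i. lam i \<noteq> 0}}"

definition skew_boxes :: "(nat \<Rightarrow> nat) \<Rightarrow> (nat \<Rightarrow> nat) \<Rightarrow> (nat \<times> nat) set" where
  "skew_boxes lam mu = {(i, j). lam i \<le> j \<and> j < mu i}"

text \<open>
  Fillings are taken to be extensional (undefined outside the shape), so that two fillings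
  are equal precisely when they agree on all boxes and can be counted with \<open>card\<close>.
\<close>

definition increasing_tableaux ::
    "(nat \<Rightarrow> nat) \<Rightarrow> (nat \<Rightarrow> nat) \<Rightarrow> (nat \<times> nat \<Rightarrow> nat) set" where
  "increasing_tableaux lam mu =
    {T \<in> skew_boxes lam mu \<rightarrow>\<^sub>E {1..}.
      (\<forall>i j j'. (i, j) \<in> skew_boxes lam mu \<longrightarrow> (i, j') \<in> skew_boxes lam mu \<longrightarrow>
        j < j' \<longrightarrow> T (i, j) < T (i, j')) \<and>
      (\<forall>i i' j. (i, j) \<in> skew_boxes lam mu \<longrightarrow> (i', j) \<in> skew_boxes lam mu \<longrightarrow>
        i < i' \<longrightarrow> T (i, j) < T (i', j))}"

text \<open>
  With rows indexed from 0, the entries allowed in row \<open>i\<close> are \<open>1, \<dots>, i\<close>; in particular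
  the top row admits no entry.
\<close>

definition flagged_tableaux ::
    "(nat \<Rightarrow> nat) \<Rightarrow> (nat \<Rightarrow> nat) \<Rightarrow> (nat \<times> nat \<Rightarrow> nat) set" where
  "flagged_tableaux lam mu =
    {T \<in> increasing_tableaux lam mu. \<forall>(i, j) \<in> skew_boxes lam mu. T (i, j) \<in> {1..i}}"

definition g :: "(nat \<Rightarrow> nat) \<Rightarrow> (nat \<Rightarrow> nat) \<Rightarrow> nat" where
  "g lam mu = card (flagged_tableaux lam mu)"

lemma finite_skew_boxes:
  assumes "mu \<in> partitions"
  shows "finite (skew_boxes lam mu)"
proof -
  have "skew_boxes lam mu \<subseteq> (SIGMA i:{i. mu i \<noteq> 0}. {..<mu i})"
    by (auto simp: skew_boxes_def)
  moreover have "finite (SIGMA i:{i. mu i \<noteq> 0}. {..<mu i})"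
    using assms by (auto simp: partitions_def intro!: finite_SigmaI)
  ultimately show ?thesis
    by (rule finite_subset)
qed

text \<open>The cardinality defining \<open>g\<close> is that of a finite set, hence a genuine count.\<close>

lemma finite_flagged_tableaux:
  assumes "mu \<in> partitions"
  shows "finite (flagged_tableaux lam mu)"
proof -
  have "flagged_tableaux lam mu \<subseteq> (\<Pi>\<^sub>E b\<in>skew_boxes lam mu. {1..fst b})"
    by (auto simp: flagged_tableaux_def increasing_tableaux_def PiE_iff extensional_def)
  moreover have "finite (\<Pi>\<^sub>E b\<in>skew_boxes lam mu. {1..fst b})"
    using finite_skew_boxes[OF assms] by (intro finite_PiE) auto
  ultimately show ?thesis
    by (rule finite_subset)
qed

lemma g_same: "g lam lam = 1"
proof -
  have "skew_boxes lam lam = {}"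
    by (auto simp: skew_boxes_def)
  then show ?thesis
    by (simp add: g_def flagged_tableaux_def increasing_tableaux_def)
qed

lemma sup_inf_in_partitions:
  assumes "lam \<in> partitions" "mu \<in> partitions"
  shows "sup lam mu \<in> partitions" "inf lam mu \<in> partitions"
proof -
  have fin: "finite ({i. lam i \<noteq> 0} \<union> {i. mu i \<noteq> 0})"
    using assms by (simp add: partitions_def)
  have "finite {i. sup lam mu i \<noteq> 0}" "finite {i. inf lam mu i \<noteq> 0}"
    by (rule finite_subset[OF _ fin]; auto simp: sup_nat_def inf_nat_def)+
  moreover have "antimono (sup lam mu)" "antimono (inf lam mu)"
    using assms by (auto simp: partitions_def antimono_def
        intro: le_supI1 le_supI2 le_infI1 le_infI2)
  ultimately show "sup lam mu \<in> partitions" "inf lam mu \<in> partitions"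
    by (auto simp: partitions_def)
qed

end

theory Submission
  imports Defs
begin

text \<open>
  A flagged tableau \<open>T\<close> of shape \<open>mu/lam\<close> is the same thing as the growing sequence of regions
  \<open>E\<^sub>k\<close>, where \<open>E\<^sub>k\<close> consists of the boxes of \<open>lam\<close> together with the boxes whose entry is at
  most \<open>k\<close>. Row \<open>i\<close> is finished at time \<open>i\<close> because its entries are bounded by \<open>i\<close>, so only the
  times \<open>k \<le> i\<close> are recorded there, and a tableau becomes a finite set of triples
  \<open>((i, j), k)\<close> from which \<open>lam\<close> is read off at \<open>k = 0\<close> and \<open>mu\<close> at \<open>k = i\<close>.

  The point of this encoding is that strictness along rows and columns turns into
  implications with one premise, from one triple belonging to the set to another one
  belonging to it. A family of sets cut out by such implications is closed under union and
  intersection, and taking the union or intersection of two encodings takes the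
  componentwise maximum or minimum of both the inner and the outer partitions. So if \<open>\<A>\<close> and
  \<open>\<B>\<close> encode the tableaux of shapes \<open>mu/lam\<close> and \<open>rho/nu\<close>, all \<open>A \<union> B\<close> encode tableaux of the
  shape of the maxima and all \<open>A \<inter> B\<close> tableaux of the shape of the minima
  (\<open>tableau_filtrations_Un\<close>, \<open>tableau_filtrations_Int\<close>). The inequality is then Daykin's
  \<open>|\<A>| |\<B>| \<le> |{A \<union> B}| |{A \<inter> B}|\<close> (\<open>card_mult_le_card_Un_Int\<close>), a consequence of the
  Ahlswede--Daykin four functions theorem (\<open>four_functions\<close>).
\<close>

section \<open>The four functions theorem\<close>

text \<open>
  The case of a one-element ground set. The two mixed products \<open>x = a0 * b1\<close> and
  \<open>y = a1 * b0\<close> are both at most \<open>P = c1 * d0\<close>, and \<open>x * y \<le> P * Q\<close> with \<open>Q = c0 * d1\<close>. Hence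
  \<open>P * (x + y) \<le> P * P + x * y \<le> P * (P + Q)\<close>, because \<open>(P - x) * (P - y) \<ge> 0\<close>.
\<close>

lemma four_functions_singleton:
  fixes a0 a1 b0 b1 c0 c1 d0 d1 :: "'a :: linordered_idom"
  assumes nonneg: "0 \<le> a0" "0 \<le> a1" "0 \<le> b0" "0 \<le> b1" "0 \<le> c0" "0 \<le> c1" "0 \<le> d0" "0 \<le> d1"
    and le00: "a0 * b0 \<le> c0 * d0" and le01: "a0 * b1 \<le> c1 * d0"
    and le10: "a1 * b0 \<le> c1 * d0" and le11: "a1 * b1 \<le> c1 * d1"
  shows "(a0 + a1) * (b0 + b1) \<le> (c0 + c1) * (d0 + d1)"
proof -
  define x y P Q where "x = a0 * b1" and "y = a1 * b0" and "P = c1 * d0" and "Q = c0 * d1"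
  have bounds: "0 \<le> x" "0 \<le> y" "x \<le> P" "y \<le> P" "0 \<le> Q"
    using assms by (simp_all add: x_def y_def P_def Q_def)
  have "x * y = (a0 * b0) * (a1 * b1)"
    by (simp add: x_def y_def)
  also have "\<dots> \<le> (c0 * d0) * (c1 * d1)"
    using nonneg by (intro mult_mono le00 le11) simp_all
  also have "\<dots> = P * Q"
    by (simp add: P_def Q_def)
  finally have xy: "x * y \<le> P * Q" .
  have mixed: "x + y \<le> P + Q"
  proof (cases "P = 0")
    case True
    then show ?thesis
      using bounds by simp
  next
    case False
    have "0 \<le> (P - x) * (P - y)"
      using bounds by simp
    then have "P * (x + y) \<le> P * P + x * y"
      by (simp add: algebra_simps)
    also have "\<dots> \<le> P * (P + Q)"
      using xy by (simp add: algebra_simps)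
    finally show ?thesis
      using False bounds by (simp add: mult_le_cancel_left)
  qed
  have "(a0 + a1) * (b0 + b1) = a0 * b0 + a1 * b1 + (x + y)"
    by (simp add: x_def y_def algebra_simps)
  also have "\<dots> \<le> c0 * d0 + c1 * d1 + (P + Q)"
    by (intro add_mono le00 le11 mixed)
  also have "\<dots> = (c0 + c1) * (d0 + d1)"
    by (simp add: P_def Q_def algebra_simps)
  finally show ?thesis .
qed

lemma sum_Pow_insert:
  fixes f :: "'a set \<Rightarrow> 'b :: comm_monoid_add"
  assumes "finite S" and "x \<notin> S"
  shows "sum f (Pow (insert x S)) = (\<Sum>A\<in>Pow S. f A + f (insert x A))"
proof -
  have inj: "inj_on (insert x) (Pow S)"
    using assms(2) by (auto simp: inj_on_def)
  have "sum f (Pow (insert x S)) = sum f (Pow S) + sum f (insert x ` Pow S)"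
    unfolding Pow_insert using assms by (intro sum.union_disjoint) auto
  also have "sum f (insert x ` Pow S) = (\<Sum>A\<in>Pow S. f (insert x A))"
    using inj by (simp add: sum.reindex)
  finally show ?thesis
    by (simp add: sum.distrib)
qed

text \<open>
  Adding a point \<open>x\<close> to the ground set, the sums over \<open>Pow (insert x S)\<close> become sums over
  \<open>Pow S\<close> of \<open>A \<mapsto> f A + f (insert x A)\<close>. The four functions so obtained satisfy the
  hypothesis again, by the case of the one-element ground set \<open>{x}\<close>.
\<close>

theorem four_functions:
  fixes \<alpha> \<beta> \<gamma> \<delta> :: "'a set \<Rightarrow> 'b :: linordered_idom"
  assumes "finite S"
    and "\<And>A. A \<subseteq> S \<Longrightarrow> 0 \<le> \<alpha> A \<and> 0 \<le> \<beta> A \<and> 0 \<le> \<gamma> A \<and> 0 \<le> \<delta> A"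
    and "\<And>A B. A \<subseteq> S \<Longrightarrow> B \<subseteq> S \<Longrightarrow> \<alpha> A * \<beta> B \<le> \<gamma> (A \<union> B) * \<delta> (A \<inter> B)"
  shows "sum \<alpha> (Pow S) * sum \<beta> (Pow S) \<le> sum \<gamma> (Pow S) * sum \<delta> (Pow S)"
  using assms
proof (induction S arbitrary: \<alpha> \<beta> \<gamma> \<delta> rule: finite_induct)
  case empty
  then show ?case
    using empty(2)[of "{}" "{}"] by simp
next
  case (insert x S)
  let ?ext = "\<lambda>f A. f A + f (insert x A)"
  have sub: "A \<subseteq> insert x S" "insert x A \<subseteq> insert x S" if "A \<subseteq> S" for A
    using that by auto
  have "sum (?ext \<alpha>) (Pow S) * sum (?ext \<beta>) (Pow S) \<le> sum (?ext \<gamma>) (Pow S) * sum (?ext \<delta>) (Pow S)"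
  proof (rule insert.IH)
    fix A assume "A \<subseteq> S"
    then show "0 \<le> ?ext \<alpha> A \<and> 0 \<le> ?ext \<beta> A \<and> 0 \<le> ?ext \<gamma> A \<and> 0 \<le> ?ext \<delta> A"
      using insert.prems(1) sub by simp
  next
    fix A B assume A: "A \<subseteq> S" and B: "B \<subseteq> S"
    then have notin: "x \<notin> A" "x \<notin> B"
      using insert.hyps by auto
    have AB: "A \<union> B \<subseteq> S" "A \<inter> B \<subseteq> S"
      using A B by auto
    show "?ext \<alpha> A * ?ext \<beta> B \<le> ?ext \<gamma> (A \<union> B) * ?ext \<delta> (A \<inter> B)"
    proof (rule four_functions_singleton)
      show "\<alpha> A * \<beta> B \<le> \<gamma> (A \<union> B) * \<delta> (A \<inter> B)"
        using insert.prems(2)[of A B] sub A B by simp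
      show "\<alpha> A * \<beta> (insert x B) \<le> \<gamma> (insert x (A \<union> B)) * \<delta> (A \<inter> B)"
        using insert.prems(2)[of A "insert x B"] sub A B notin by simp
      show "\<alpha> (insert x A) * \<beta> B \<le> \<gamma> (insert x (A \<union> B)) * \<delta> (A \<inter> B)"
        using insert.prems(2)[of "insert x A" B] sub A B notin by simp
      show "\<alpha> (insert x A) * \<beta> (insert x B) \<le> \<gamma> (insert x (A \<union> B)) * \<delta> (insert x (A \<inter> B))"
        using insert.prems(2)[of "insert x A" "insert x B"] sub A B notin by simp
    qed (use insert.prems(1) sub A B AB in blast)+
  qed
  then show ?case
    by (simp add: sum_Pow_insert insert.hyps)
qed

text \<open>
  The four functions theorem for the indicator functions of \<open>\<A>\<close>, \<open>\<B>\<close>, the family of all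
  unions and the family of all intersections.
\<close>

corollary card_mult_le_card_Un_Int:
  fixes \<A> \<B> :: "'a set set"
  assumes "finite (\<Union>\<A>)" and "finite (\<Union>\<B>)"
  shows "card \<A> * card \<B> \<le>
    card ((\<lambda>(A, B). A \<union> B) ` (\<A> \<times> \<B>)) * card ((\<lambda>(A, B). A \<inter> B) ` (\<A> \<times> \<B>))"
proof -
  define S where "S = \<Union>\<A> \<union> \<Union>\<B>"
  define \<U> where "\<U> = (\<lambda>(A, B). A \<union> B) ` (\<A> \<times> \<B>)"
  define \<I> where "\<I> = (\<lambda>(A, B). A \<inter> B) ` (\<A> \<times> \<B>)"
  have fin: "finite S"
    using assms by (simp add: S_def)
  have sum_indicator: "(\<Sum>A\<in>Pow S. of_bool (A \<in> \<F>)) = int (card \<F>)" if "\<F> \<subseteq> Pow S" for \<F>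
    using that fin by (simp add: Int_absorb1 sum.If_cases of_bool_def)
  have "(\<Sum>A\<in>Pow S. of_bool (A \<in> \<A>)) * (\<Sum>A\<in>Pow S. of_bool (A \<in> \<B>)) \<le>
      (\<Sum>A\<in>Pow S. of_bool (A \<in> \<U>)) * ((\<Sum>A\<in>Pow S. of_bool (A \<in> \<I>)) :: int)"
    by (rule four_functions[OF fin]) (auto simp: \<U>_def \<I>_def)
  moreover have "\<A> \<subseteq> Pow S" "\<B> \<subseteq> Pow S" "\<U> \<subseteq> Pow S" "\<I> \<subseteq> Pow S"
    by (auto simp: S_def \<U>_def \<I>_def)
  ultimately have "int (card \<A>) * int (card \<B>) \<le> int (card \<U>) * int (card \<I>)"
    by (simp add: sum_indicator)
  then show ?thesis
    by (simp add: \<U>_def \<I>_def flip: of_nat_mult)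
qed

section \<open>Flagged tableaux as sets of timed boxes\<close>

definition filtration_of ::
    "(nat \<Rightarrow> nat) \<Rightarrow> (nat \<Rightarrow> nat) \<Rightarrow> (nat \<times> nat \<Rightarrow> nat) \<Rightarrow> ((nat \<times> nat) \<times> nat) set" where
  "filtration_of lam mu T =
    {((i, j), k). k \<le> i \<and> (j < lam i \<or> j < mu i \<and> T (i, j) \<le> k)}"

text \<open>
  The sets \<open>filtration_of lam mu T\<close> for flagged tableaux \<open>T\<close>, described so that closure
  under union and intersection is visible clause by clause: each implication has only one
  premise about \<open>E\<close>, and the boundary conditions at \<open>k = 0\<close> and \<open>k = i\<close> turn unions and
  intersections into maxima and minima. The last two clauses are the strictness along rows
  and columns. In the column clause \<open>k \<le> i\<close> loses nothing: from time \<open>i\<close> on, row \<open>i\<close> is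
  complete.
\<close>

definition tableau_filtrations ::
    "(nat \<Rightarrow> nat) \<Rightarrow> (nat \<Rightarrow> nat) \<Rightarrow> ((nat \<times> nat) \<times> nat) set set" where
  "tableau_filtrations lam mu =
    {E. (\<forall>i j k. ((i, j), k) \<in> E \<longrightarrow> k \<le> i) \<and>
      (\<forall>i j. ((i, j), 0) \<in> E \<longleftrightarrow> j < lam i) \<and>
      (\<forall>i j. ((i, j), i) \<in> E \<longleftrightarrow> j < mu i) \<and>
      (\<forall>i j k l. ((i, j), k) \<in> E \<longrightarrow> k \<le> l \<longrightarrow> l \<le> i \<longrightarrow> ((i, j), l) \<in> E) \<and>
      (\<forall>i j j' k. ((i, j'), Suc k) \<in> E \<longrightarrow> j < j' \<longrightarrow> ((i, j), k) \<in> E) \<and>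
      (\<forall>i i' j k. ((i', j), Suc k) \<in> E \<longrightarrow> i < i' \<longrightarrow> k \<le> i \<longrightarrow> ((i, j), k) \<in> E)}"

lemma tableau_filtrationsD:
  assumes "E \<in> tableau_filtrations lam mu"
  shows "((i, j), k) \<in> E \<Longrightarrow> k \<le> i"
    and "((i, j), 0) \<in> E \<longleftrightarrow> j < lam i"
    and "((i, j), i) \<in> E \<longleftrightarrow> j < mu i"
    and "((i, j), k) \<in> E \<Longrightarrow> k \<le> l \<Longrightarrow> l \<le> i \<Longrightarrow> ((i, j), l) \<in> E"
    and "((i, j'), Suc k) \<in> E \<Longrightarrow> j < j' \<Longrightarrow> ((i, j), k) \<in> E"
    and "((i', j), Suc k) \<in> E \<Longrightarrow> i < i' \<Longrightarrow> k \<le> i \<Longrightarrow> ((i, j), k) \<in> E"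
  using assms unfolding tableau_filtrations_def mem_Collect_eq by (elim conjE; metis)+

lemma tableau_filtrations_Un:
  assumes "E \<in> tableau_filtrations lam mu" and "F \<in> tableau_filtrations nu rho"
  shows "E \<union> F \<in> tableau_filtrations (sup lam nu) (sup mu rho)"
  unfolding tableau_filtrations_def
proof (intro CollectI conjI)
  note E = tableau_filtrationsD[OF assms(1)] and F = tableau_filtrationsD[OF assms(2)]
  show "\<forall>i j k. ((i, j), k) \<in> E \<union> F \<longrightarrow> k \<le> i"
    using E(1) F(1) by blast
  show "\<forall>i j. ((i, j), 0) \<in> E \<union> F \<longleftrightarrow> j < (sup lam nu) i"
    by (simp add: E(2) F(2) sup_nat_def less_max_iff_disj)
  show "\<forall>i j. ((i, j), i) \<in> E \<union> F \<longleftrightarrow> j < (sup mu rho) i"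
    by (simp add: E(3) F(3) sup_nat_def less_max_iff_disj)
  show "\<forall>i j k l. ((i, j), k) \<in> E \<union> F \<longrightarrow> k \<le> l \<longrightarrow> l \<le> i \<longrightarrow> ((i, j), l) \<in> E \<union> F"
    using E(4) F(4) by blast
  show "\<forall>i j j' k. ((i, j'), Suc k) \<in> E \<union> F \<longrightarrow> j < j' \<longrightarrow> ((i, j), k) \<in> E \<union> F"
    using E(5) F(5) by blast
  show "\<forall>i i' j k. ((i', j), Suc k) \<in> E \<union> F \<longrightarrow> i < i' \<longrightarrow> k \<le> i \<longrightarrow> ((i, j), k) \<in> E \<union> F"
    using E(6) F(6) by blast
qed

lemma tableau_filtrations_Int:
  assumes "E \<in> tableau_filtrations lam mu" and "F \<in> tableau_filtrations nu rho"
  shows "E \<inter> F \<in> tableau_filtrations (inf lam nu) (inf mu rho)"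
  unfolding tableau_filtrations_def
proof (intro CollectI conjI)
  note E = tableau_filtrationsD[OF assms(1)] and F = tableau_filtrationsD[OF assms(2)]
  show "\<forall>i j k. ((i, j), k) \<in> E \<inter> F \<longrightarrow> k \<le> i"
    using E(1) F(1) by blast
  show "\<forall>i j. ((i, j), 0) \<in> E \<inter> F \<longleftrightarrow> j < (inf lam nu) i"
    by (simp add: E(2) F(2) inf_nat_def)
  show "\<forall>i j. ((i, j), i) \<in> E \<inter> F \<longleftrightarrow> j < (inf mu rho) i"
    by (simp add: E(3) F(3) inf_nat_def)
  show "\<forall>i j k l. ((i, j), k) \<in> E \<inter> F \<longrightarrow> k \<le> l \<longrightarrow> l \<le> i \<longrightarrow> ((i, j), l) \<in> E \<inter> F"
    using E(4) F(4) by blast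
  show "\<forall>i j j' k. ((i, j'), Suc k) \<in> E \<inter> F \<longrightarrow> j < j' \<longrightarrow> ((i, j), k) \<in> E \<inter> F"
    using E(5) F(5) by blast
  show "\<forall>i i' j k. ((i', j), Suc k) \<in> E \<inter> F \<longrightarrow> i < i' \<longrightarrow> k \<le> i \<longrightarrow> ((i, j), k) \<in> E \<inter> F"
    using E(6) F(6) by blast
qed

lemma finite_Union_tableau_filtrations:
  assumes "mu \<in> partitions"
  shows "finite (\<Union>(tableau_filtrations lam mu))"
proof (rule finite_subset)
  show "\<Union>(tableau_filtrations lam mu) \<subseteq> (SIGMA b:skew_boxes (\<lambda>_. 0) mu. {..fst b})"
  proof
    fix t assume "t \<in> \<Union>(tableau_filtrations lam mu)"
    then obtain i j k E where E: "E \<in> tableau_filtrations lam mu" and t: "t = ((i, j), k)" "t \<in> E"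
      by (metis UnionE surj_pair)
    note D = tableau_filtrationsD[OF E]
    have "k \<le> i"
      using D(1) t by blast
    moreover have "j < mu i"
      using D(3) D(4)[of i j k i] t \<open>k \<le> i\<close> by blast
    ultimately show "t \<in> (SIGMA b:skew_boxes (\<lambda>_. 0) mu. {..fst b})"
      by (simp add: t skew_boxes_def)
  qed
  show "finite (SIGMA b:skew_boxes (\<lambda>_. 0) mu. {..fst b})"
    using finite_skew_boxes[OF assms] by auto
qed

lemma partitions_antimonoD:
  assumes "lam \<in> partitions" and "i \<le> i'"
  shows "lam i' \<le> lam i"
  using assms by (auto simp: partitions_def antimono_def)

lemma flagged_tableauxD:
  assumes "T \<in> flagged_tableaux lam mu" and "lam i \<le> j" and "j < mu i"
  shows "1 \<le> T (i, j)" and "T (i, j) \<le> i"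
    and "\<And>j'. j < j' \<Longrightarrow> j' < mu i \<Longrightarrow> T (i, j) < T (i, j')"
    and "\<And>i'. i < i' \<Longrightarrow> lam i' \<le> j \<Longrightarrow> j < mu i' \<Longrightarrow> T (i, j) < T (i', j)"
  using assms by (auto simp: flagged_tableaux_def increasing_tableaux_def skew_boxes_def)

lemma filtration_of_in_tableau_filtrations:
  assumes part: "lam \<in> partitions" "mu \<in> partitions" and le: "lam \<le> mu"
    and T: "T \<in> flagged_tableaux lam mu"
  shows "filtration_of lam mu T \<in> tableau_filtrations lam mu"
proof -
  note D = flagged_tableauxD[OF T]
  have row: "((i, j), k) \<in> filtration_of lam mu T"
    if "((i, j'), Suc k) \<in> filtration_of lam mu T" "j < j'" for i j j' k
    using that D(3)[of i j j'] by (fastforce simp: filtration_of_def not_less)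
  have col: "((i, j), k) \<in> filtration_of lam mu T"
    if "((i', j), Suc k) \<in> filtration_of lam mu T" "i < i'" "k \<le> i" for i i' j k
    using that D(4)[of i j i'] partitions_antimonoD[OF part(1), of i i']
      partitions_antimonoD[OF part(2), of i i']
    by (fastforce simp: filtration_of_def not_less)
  have lam: "((i, j), 0) \<in> filtration_of lam mu T \<longleftrightarrow> j < lam i" for i j
    using D(1)[of i j] by (fastforce simp: filtration_of_def)
  have mu: "((i, j), i) \<in> filtration_of lam mu T \<longleftrightarrow> j < mu i" for i j
    using D(2)[of i j] le_funD[OF le, of i] by (auto simp: filtration_of_def)
  show ?thesis
    unfolding tableau_filtrations_def
  proof (intro CollectI conjI)
    show "\<forall>i j k. ((i, j), k) \<in> filtration_of lam mu T \<longrightarrow> k \<le> i"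
      "\<forall>i j k l. ((i, j), k) \<in> filtration_of lam mu T \<longrightarrow> k \<le> l \<longrightarrow> l \<le> i \<longrightarrow>
        ((i, j), l) \<in> filtration_of lam mu T"
      by (auto simp: filtration_of_def)
  qed (use row col lam mu in blast)+
qed

lemma inj_on_filtration_of:
  "inj_on (filtration_of lam mu) (flagged_tableaux lam mu)"
proof (rule inj_onI)
  fix T U
  assume T: "T \<in> flagged_tableaux lam mu" and U: "U \<in> flagged_tableaux lam mu"
    and eq: "filtration_of lam mu T = filtration_of lam mu U"
  have "T \<in> extensional (skew_boxes lam mu)" "U \<in> extensional (skew_boxes lam mu)"
    using T U by (simp_all add: flagged_tableaux_def increasing_tableaux_def PiE_iff)
  then show "T = U"
  proof (rule extensionalityI)
    fix b assume "b \<in> skew_boxes lam mu"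
    then obtain i j where b: "b = (i, j)" "lam i \<le> j" "j < mu i"
      by (auto simp: skew_boxes_def)
    have "T (i, j) \<le> k \<longleftrightarrow> U (i, j) \<le> k" if "k \<le> i" for k
    proof -
      have "((i, j), k) \<in> filtration_of lam mu T \<longleftrightarrow> ((i, j), k) \<in> filtration_of lam mu U"
        by (simp add: eq)
      then show ?thesis
        using b that by (simp add: filtration_of_def)
    qed
    then show "T b = U b"
      using flagged_tableauxD(2)[OF T b(2,3)] flagged_tableauxD(2)[OF U b(2,3)] b(1)
      by (metis order_antisym order_refl)
  qed
qed

text \<open>
  The tableau is recovered by entering in each box the first time at which the box is
  present; it is present at the latest at time \<open>i\<close>, whence the flag condition.
\<close>

lemma tableau_filtrations_subset_range:
  "tableau_filtrations lam mu \<subseteq> filtration_of lam mu ` flagged_tableaux lam mu"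
proof
  fix E assume "E \<in> tableau_filtrations lam mu"
  note D = tableau_filtrationsD[OF this]
  note bound = D(1) and start = D(2) and final = D(3) and grow = D(4) and row = D(5) and col = D(6)
  define first where "first i j = (LEAST k. ((i, j), k) \<in> E)" for i j
  have first_le: "first i j \<le> k" if "((i, j), k) \<in> E" for i j k
    unfolding first_def using that by (rule Least_le)
  have first_in: "((i, j), first i j) \<in> E" if "j < mu i" for i j
    unfolding first_def using final[of i j] that by (auto intro: LeastI)
  have first_pos: "first i j \<noteq> 0" if "lam i \<le> j" "j < mu i" for i j
    using first_in[OF that(2)] start[of i j] that by (auto intro!: gr0I)
  have first_bound: "first i j \<le> i" if "j < mu i" for i j
    using first_le final that by blast
  have mem_E: "((i, j), k) \<in> E \<longleftrightarrow> k \<le> i \<and> j < mu i \<and> first i j \<le> k" for i j k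
    using bound[of i j k] first_le[of i j k] first_in[of j i] grow[of i j] final[of i j] by blast
  have lam_le: "j < mu i \<and> first i j = 0" if "j < lam i" for i j
    using that start[of i j] mem_E[of i j 0] by simp

  have row_strict: "first i j < first i j'"
    if box: "lam i \<le> j'" "j' < mu i" and less: "j < j'" for i j j'
  proof -
    obtain k where k: "first i j' = Suc k"
      using first_pos[OF box] not0_implies_Suc by blast
    then have "((i, j), k) \<in> E"
      using first_in[OF box(2)] less by (auto intro: row)
    then show ?thesis
      using first_le k by fastforce
  qed
  have col_strict: "first i j < first i' j"
    if box: "j < mu i" "lam i' \<le> j" "j < mu i'" and less: "i < i'" for i i' j
  proof -
    obtain k where k: "first i' j = Suc k"
      using first_pos[OF box(2,3)] not0_implies_Suc by blast
    show ?thesis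
    proof (cases "k \<le> i")
      case True
      then have "((i, j), k) \<in> E"
        using first_in[OF box(3)] k less by (auto intro: col)
      then show ?thesis
        using first_le k by fastforce
    next
      \<comment> \<open>At time \<open>k > i\<close> the row above is no longer recorded, but then it is already full.\<close>
      case False
      then show ?thesis
        using first_bound[OF box(1)] k by simp
    qed
  qed

  define T where "T = restrict (\<lambda>(i, j). first i j) (skew_boxes lam mu)"
  have T_box: "T (i, j) = first i j" if "lam i \<le> j" "j < mu i" for i j
    using that by (simp add: T_def skew_boxes_def)
  have "T \<in> skew_boxes lam mu \<rightarrow>\<^sub>E {1..}"
    using first_pos by (auto simp: T_def skew_boxes_def Suc_le_eq)
  then have "T \<in> flagged_tableaux lam mu"
    using first_bound first_pos row_strict col_strict
    by (auto simp: flagged_tableaux_def increasing_tableaux_def skew_boxes_def T_box Suc_le_eq)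
  moreover have "filtration_of lam mu T = E"
  proof -
    have "((i, j), k) \<in> filtration_of lam mu T \<longleftrightarrow> ((i, j), k) \<in> E" for i j k
      using mem_E[of i j k] lam_le[of j i] T_box[of i j]
      by (cases "j < lam i") (auto simp: filtration_of_def)
    then show ?thesis
      by auto
  qed
  ultimately show "E \<in> filtration_of lam mu ` flagged_tableaux lam mu"
    by blast
qed

lemma g_eq_card_tableau_filtrations:
  assumes "lam \<in> partitions" and "mu \<in> partitions" and "lam \<le> mu"
  shows "g lam mu = card (tableau_filtrations lam mu)"
proof -
  have "filtration_of lam mu ` flagged_tableaux lam mu = tableau_filtrations lam mu"
    using filtration_of_in_tableau_filtrations[OF assms] tableau_filtrations_subset_range by blast
  then show ?thesis
    unfolding g_def using card_image[OF inj_on_filtration_of] by metis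
qed

section \<open>The inequality\<close>

theorem lemma9p2:
  fixes lam mu nu rho :: "nat \<Rightarrow> nat"
  assumes "lam \<in> partitions" and "mu \<in> partitions"
    and "nu \<in> partitions" and "rho \<in> partitions"
    and "lam \<le> mu" and "nu \<le> rho"
  shows "g lam mu * g nu rho \<le> g (sup lam nu) (sup mu rho) * g (inf lam nu) (inf mu rho)"
proof -
  let ?\<A> = "tableau_filtrations lam mu" and ?\<B> = "tableau_filtrations nu rho"
  let ?\<U> = "tableau_filtrations (sup lam nu) (sup mu rho)"
  let ?\<I> = "tableau_filtrations (inf lam nu) (inf mu rho)"
  have part: "sup lam nu \<in> partitions" "sup mu rho \<in> partitions"
    "inf lam nu \<in> partitions" "inf mu rho \<in> partitions"
    using assms by (simp_all add: sup_inf_in_partitions)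
  have le: "sup lam nu \<le> sup mu rho" "inf lam nu \<le> inf mu rho"
    using assms(5,6) by (rule sup_mono, rule inf_mono)
  have "card ?\<A> * card ?\<B> \<le>
      card ((\<lambda>(A, B). A \<union> B) ` (?\<A> \<times> ?\<B>)) * card ((\<lambda>(A, B). A \<inter> B) ` (?\<A> \<times> ?\<B>))"
    using assms by (intro card_mult_le_card_Un_Int finite_Union_tableau_filtrations)
  also have "\<dots> \<le> card ?\<U> * card ?\<I>"
    using part tableau_filtrations_Un tableau_filtrations_Int
    by (intro mult_mono card_mono finite_UnionD[OF finite_Union_tableau_filtrations]) auto
  finally show ?thesis
    using assms part le by (simp add: g_eq_card_tableau_filtrations)
qed

end
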